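(* Let $\mathcal{X}$, $\mathcal{Y}$, $\mathcal{Z}$ be finite-dimensional complex Hilbert spaces (associated with registers $\mathsf{X}$, $\mathsf{Y}$, $\mathsf{Z}$), let $\{\Delta_1,\ldots,\Delta_n\}$ be a set of nonzero, mutually orthogonal projection operators on $\mathcal{X}\otimes\mathcal{Y}$ and $\{\Lambda_1,\ldots,\Lambda_n\}$ a set of nonzero, mutually orthogonal projection operators on $\mathcal{Z}$, let \[ \Pi=\sum_{k=1}^n\Delta_k\otimes\Lambda_k, \] and let $U$ be a unitary operator on $\mathcal{X}\otimes\mathcal{Y}\otimes\mathcal{Z}$ that is $\mathsf{Y}\rightarrow\mathsf{X}$ causal on $\operatorname{im}(\Pi)$. Then for every linear operator $X$ on $\mathcal{X}$ there exists a linear operator $W$ on $\mathcal{X}\otimes\mathcal{Y}$ such that \[ \Pi U^{\ast}(X\otimes\mathbb{1}_{\mathcal{Y}\otimes\mathcal{Z}})U\Pi=\Pi(W\otimes\mathbb{1}_{\mathcal{Z}})\Pi . \] If, in addition, $X$ is unitary and $U^{\ast}(X\otimes\mathbb{1}_{\mathcal{Y}\otimes\mathcal{Z}})U$ commutes with $\Pi$, then $W$ may also be taken to be unitary.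
   Context: Definition: a unitary operator $U$ on $\mathcal{X}\otimes\mathcal{Y}\otimes\mathcal{Z}$ is $\mathsf{Y}\rightarrow\mathsf{X}$ causal on a subspace $\mathcal{V}\subseteq\mathcal{X}\otimes\mathcal{Y}\otimes\mathcal{Z}$ if for every pair of density operators $\rho,\sigma$ on $\mathcal{X}\otimes\mathcal{Y}\otimes\mathcal{Z}$ with $\operatorname{im}(\rho)\subseteq\mathcal{V}$, $\operatorname{im}(\sigma)\subseteq\mathcal{V}$ and $\operatorname{Tr}_{\mathcal{Z}}(\rho)=\operatorname{Tr}_{\mathcal{Z}}(\sigma)$, one has $\operatorname{Tr}_{\mathcal{Y}\otimes\mathcal{Z}}(U\rho U^{\ast})=\operatorname{Tr}_{\mathcal{Y}\otimes\mathcal{Z}}(U\sigma U^{\ast})$. *)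

theory Defs
  imports "HOL-Analysis.Analysis"
begin

text \<open>
  A finite-dimensional complex Hilbert space is \<open>complex ^ 'a\<close> with \<open>'a\<close> finite, an operator on it
  is its matrix, and the tensor product of the spaces indexed by \<open>'a\<close> and \<open>'b\<close> is indexed by
  \<open>'a \<times> 'b\<close>.  A threefold tensor product is bracketed to the left, as \<open>('x \<times> 'y) \<times> 'z\<close>.
\<close>

type_synonym 'a op = "complex ^ 'a ^ 'a"

definition adj :: "'a::finite op \<Rightarrow> 'a op"
  where "adj A = (\<chi> i j. cnj (A $ j $ i))"

definition cinner :: "complex ^ 'a::finite \<Rightarrow> complex ^ 'a \<Rightarrow> complex"
  where "cinner v w = (\<Sum>i\<in>UNIV. cnj (v $ i) * w $ i)"

definition im :: "'a::finite op \<Rightarrow> (complex ^ 'a) set"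
  where "im A = range (\<lambda>v. A *v v)"

definition unitary :: "'a::finite op \<Rightarrow> bool"
  where "unitary U \<longleftrightarrow> adj U ** U = mat 1 \<and> U ** adj U = mat 1"

definition projection :: "'a::finite op \<Rightarrow> bool"
  where "projection P \<longleftrightarrow> adj P = P \<and> P ** P = P"

definition positive_semidefinite :: "'a::finite op \<Rightarrow> bool"
  where "positive_semidefinite A \<longleftrightarrow> adj A = A \<and> (\<forall>v. 0 \<le> Re (cinner v (A *v v)))"

definition density_operator :: "'a::finite op \<Rightarrow> bool"
  where "density_operator \<rho> \<longleftrightarrow> positive_semidefinite \<rho> \<and> trace \<rho> = 1"

definition tensor_op :: "'a::finite op \<Rightarrow> 'b::finite op \<Rightarrow> ('a \<times> 'b) op"  (infixl \<open>\<otimes>\<close> 75)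
  where "A \<otimes> B = (\<chi> p q. A $ fst p $ fst q * B $ snd p $ snd q)"

definition partial_trace_snd :: "('a::finite \<times> 'b::finite) op \<Rightarrow> 'a op"
  where "partial_trace_snd A = (\<chi> i j. \<Sum>k\<in>UNIV. A $ (i, k) $ (j, k))"

definition Tr_Z :: "(('x::finite \<times> 'y::finite) \<times> 'z::finite) op \<Rightarrow> ('x \<times> 'y) op"
  where "Tr_Z A = partial_trace_snd A"

definition Tr_YZ :: "(('x::finite \<times> 'y::finite) \<times> 'z::finite) op \<Rightarrow> 'x op"
  where "Tr_YZ A = partial_trace_snd (partial_trace_snd A)"

definition causal_Y_to_X ::
  "(('x::finite \<times> 'y::finite) \<times> 'z::finite) op \<Rightarrow> (complex ^ (('x \<times> 'y) \<times> 'z)) set \<Rightarrow> bool"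
  where "causal_Y_to_X U V \<longleftrightarrow>
    (\<forall>\<rho> \<sigma>. density_operator \<rho> \<longrightarrow> density_operator \<sigma> \<longrightarrow> im \<rho> \<subseteq> V \<longrightarrow> im \<sigma> \<subseteq> V \<longrightarrow>
      Tr_Z \<rho> = Tr_Z \<sigma> \<longrightarrow> Tr_YZ (U ** \<rho> ** adj U) = Tr_YZ (U ** \<sigma> ** adj U))"

end

theory Submission imports Defs begin

text \<open>
  If \<open>A = P A P\<close> has vanishing partial trace over Z, then \<open>Tr\<^sub>Y\<^sub>Z (U A U\<^sup>*) = 0\<close>: for Hermitian
  \<open>A\<close> compare the states proportional to \<open>A + c P\<close> and \<open>c P\<close> with \<open>c\<close> large, and split a general
  \<open>A\<close> into Hermitian parts.  Hence the functional \<open>B \<mapsto> Tr (U\<^sup>* X U B)\<close> on operators \<open>B = P B P\<close>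
  depends only on the partial trace of \<open>B\<close>, so \<open>B\<close> may be replaced by a combination of operators
  \<open>\<Delta>\<^sub>k R\<^sub>k \<Delta>\<^sub>k \<otimes> \<Lambda>\<^sub>k\<close> with the same partial trace.  This exhibits the functional as
  \<open>B \<mapsto> Tr ((W \<otimes> 1) B)\<close> for a block-diagonal \<open>W = \<Sum>\<^sub>k \<Delta>\<^sub>k V\<^sub>k \<Delta>\<^sub>k\<close>, and nondegeneracy of the trace
  form gives the factorization.  In the unitary case \<open>W\<close> is unitary on the image of
  \<open>D = \<Sum>\<^sub>k \<Delta>\<^sub>k\<close>, and \<open>W + (1 - D)\<close> is the required unitary.
\<close>

section \<open>Matrix products with sums, complex scalars and traces\<close>

lemma matrix_mul_nth: "(A ** B) $ i $ j = (\<Sum>k\<in>UNIV. A $ i $ k * B $ k $ j)"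
  by (simp add: matrix_matrix_mult_def)

lemma matrix_mul_sum_left:
  fixes A :: "'i \<Rightarrow> ('a::semiring_1) ^ 'n ^ 'm"
  shows "(\<Sum>i\<in>I. A i) ** B = (\<Sum>i\<in>I. A i ** B)"
  by (simp add: vec_eq_iff matrix_mul_nth sum_distrib_right) (intro allI sum.swap)

lemma matrix_mul_sum_right:
  fixes A :: "'i \<Rightarrow> ('a::semiring_1) ^ 'n ^ 'm"
  shows "B ** (\<Sum>i\<in>I. A i) = (\<Sum>i\<in>I. B ** A i)"
  by (simp add: vec_eq_iff matrix_mul_nth sum_distrib_left) (intro allI sum.swap)

lemma zero_matrix_mul [simp]:
  "0 ** A = (0 :: ('a::semiring_1) ^ 'n ^ 'm)" "A ** 0 = (0 :: ('a::semiring_1) ^ 'n ^ 'm)"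
  by (simp_all add: vec_eq_iff matrix_mul_nth)

lemma matrix_add_rdistrib: "(A + B) ** C = A ** C + B ** (C :: ('a::semiring_1) ^ 'n ^ 'm)"
  by (simp add: vec_eq_iff matrix_mul_nth algebra_simps sum.distrib)

lemma matrix_mul_diff_left: "(A - B) ** C = A ** C - B ** (C :: ('a::ring_1) ^ 'n ^ 'm)"
  by (simp add: vec_eq_iff matrix_mul_nth algebra_simps sum_subtractf)

lemma matrix_mul_diff_right: "C ** (A - B) = C ** A - C ** (B :: ('a::ring_1) ^ 'n ^ 'm)"
  by (simp add: vec_eq_iff matrix_mul_nth algebra_simps sum_subtractf)

text \<open>Left multiplication by \<open>mat c\<close> is the scalar multiple by \<open>c\<close>;
  it takes the place of \<open>*\<^sub>R\<close> when the scalar is not real, such as \<i>.\<close>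

lemma mat_scalar_mul_nth: "(mat c ** A) $ i $ j = c * (A :: ('a::semiring_1) ^ 'n ^ 'm) $ i $ j"
  by (simp add: matrix_mul_nth mat_def if_distrib [of "\<lambda>x. x * _"] cong: if_cong)

lemma mat_scalar_mul_commute: "A ** (mat c ** B) = mat c ** (A ** (B :: ('a::comm_semiring_1) ^ 'n ^ 'm))"
  by (simp add: vec_eq_iff mat_scalar_mul_nth)
    (simp add: matrix_mul_nth [of A] mat_scalar_mul_nth sum_distrib_left mult_ac)

lemma trace_sum: "trace (\<Sum>i\<in>I. A i) = (\<Sum>i\<in>I. trace (A i :: ('a::semiring_1) ^ 'n ^ 'n))"
  by (simp add: trace_def) (rule sum.swap)

lemma trace_scaleR: "trace (c *\<^sub>R A) = c *\<^sub>R trace (A :: ('a::real_algebra_1) ^ 'n ^ 'n)"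
  by (simp add: trace_def scaleR_sum_right)

section \<open>Adjoints and the Hilbert-Schmidt trace form\<close>

lemma adj_mul: "adj (A ** B) = adj B ** adj A"
  by (simp add: adj_def vec_eq_iff matrix_mul_nth mult_ac)

lemma adj_adj [simp]: "adj (adj A) = A"
  by (simp add: adj_def vec_eq_iff)

lemma adj_mat_1 [simp]: "adj (mat 1) = mat 1"
  by (simp add: adj_def mat_def vec_eq_iff)

lemma adj_add: "adj (A + B) = adj A + adj B"
  by (simp add: adj_def vec_eq_iff)

lemma adj_diff: "adj (A - B) = adj A - adj B"
  by (simp add: adj_def vec_eq_iff)

lemma adj_scaleR: "adj (c *\<^sub>R A) = c *\<^sub>R adj A"
  by (simp add: adj_def vec_eq_iff)

lemma adj_sum: "adj (\<Sum>i\<in>I. A i) = (\<Sum>i\<in>I. adj (A i))"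
  by (simp add: adj_def vec_eq_iff)

lemma adj_mat_scalar_mul: "adj (mat c ** A) = mat (cnj c) ** adj A"
  by (simp add: vec_eq_iff mat_scalar_mul_nth) (simp add: adj_def mat_scalar_mul_nth)

text \<open>This is the squared Hilbert-Schmidt norm of \<open>A\<close>, the source of both the
  nondegeneracy of the trace form and the positivity of traces of projections.\<close>

lemma trace_mul_adj: "trace (A ** adj A) = of_real (\<Sum>i\<in>UNIV. \<Sum>j\<in>UNIV. (cmod (A $ i $ j))\<^sup>2)"
  by (simp add: trace_def matrix_mul_nth adj_def complex_norm_square del: of_real_power)

lemma trace_mul_adj_eq_0:
  assumes "trace (A ** adj A) = 0"
  shows "A = 0"
proof -
  have "(\<Sum>i\<in>UNIV. \<Sum>j\<in>UNIV. (cmod (A $ i $ j))\<^sup>2) = 0"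
    using assms by (simp only: trace_mul_adj of_real_eq_0_iff)
  then show ?thesis
    by (simp add: sum_nonneg_eq_0_iff sum_nonneg vec_eq_iff)
qed

text \<open>Nondegeneracy of the trace form: testing with the adjoint of \<open>A - B\<close> makes
  the squared Hilbert-Schmidt norm of the difference vanish.\<close>

lemma trace_mul_eqI:
  assumes "\<And>C. trace (A ** C) = trace (B ** C)"
  shows "A = (B :: 'a::finite op)"
proof -
  have "trace ((A - B) ** adj (A - B)) = 0"
    by (simp add: matrix_mul_diff_left trace_sub assms)
  from trace_mul_adj_eq_0 [OF this] show ?thesis by simp
qed

text \<open>As \<open>Q = Q ** adj Q\<close>, the trace is a squared Hilbert-Schmidt norm.
  Positivity for nonzero \<open>Q\<close> later permits division by the traces of \<open>P\<close>
  and of the \<Lambda> projections.\<close>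

lemma trace_projection:
  assumes "projection Q"
  obtains t where "trace Q = of_real t" and "t \<ge> 0" and "Q \<noteq> 0 \<Longrightarrow> t > 0"
proof -
  let ?t = "\<Sum>i\<in>UNIV. \<Sum>j\<in>UNIV. (cmod (Q $ i $ j))\<^sup>2"
  have Q: "Q ** adj Q = Q" using assms by (simp add: projection_def)
  have tr: "trace Q = of_real ?t" using trace_mul_adj [of Q] unfolding Q .
  have nn: "?t \<ge> 0" by (simp add: sum_nonneg)
  have "?t > 0" if "Q \<noteq> 0"
  proof -
    have "?t \<noteq> 0"
      using trace_mul_adj_eq_0 [of Q] that Q tr by (metis of_real_0)
    with nn show ?thesis by linarith
  qed
  with that tr nn show ?thesis by blast
qed

section \<open>Tensor products and partial traces\<close>

lemma tensor_nth: "(A \<otimes> B) $ (i, k) $ (j, l) = A $ i $ j * B $ k $ l"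
  by (simp add: tensor_op_def)

lemma tensor_mul: "(A \<otimes> B) ** (C \<otimes> D) = (A ** C) \<otimes> (B ** D)"
proof -
  have "((A \<otimes> B) ** (C \<otimes> D)) $ (i, k) $ (j, l) = ((A ** C) \<otimes> (B ** D)) $ (i, k) $ (j, l)"
    for i j k l
    by (simp add: matrix_mul_nth tensor_nth sum_product sum.cartesian_product UNIV_Times_UNIV [symmetric]
        case_prod_unfold tensor_op_def mult_ac del: UNIV_Times_UNIV)
  then show ?thesis by (simp add: vec_eq_iff)
qed

lemma adj_tensor: "adj (A \<otimes> B) = adj A \<otimes> adj B"
  by (simp add: vec_eq_iff adj_def tensor_op_def)

lemma tensor_mat_1: "mat 1 \<otimes> mat 1 = mat 1"
  by (auto simp add: vec_eq_iff mat_def tensor_op_def)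

lemma tensor_add_left: "(A + B) \<otimes> C = A \<otimes> C + B \<otimes> C"
  by (simp add: vec_eq_iff tensor_op_def algebra_simps)

lemma partial_trace_nth: "partial_trace_snd A $ i $ j = (\<Sum>k\<in>UNIV. A $ (i, k) $ (j, k))"
  by (simp add: partial_trace_snd_def)

lemma sum_UNIV_prod:
  "(\<Sum>p\<in>(UNIV :: ('a::finite \<times> 'b::finite) set). f p) = (\<Sum>a\<in>UNIV. \<Sum>b\<in>UNIV. f (a, b))"
  by (simp add: sum.cartesian_product UNIV_Times_UNIV [symmetric] del: UNIV_Times_UNIV)

lemma sum_mat_1_left:
  "(\<Sum>l\<in>UNIV. a * (mat 1 :: 'b::finite op) $ k $ l * f l) = a * f k"
  by (simp add: mat_def if_distrib [of "\<lambda>x. _ * x"] if_distrib [of "\<lambda>x. x * _"] cong: if_cong)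

lemma sum_mat_1_right:
  "(\<Sum>l\<in>UNIV. f l * (a * (mat 1 :: 'b::finite op) $ l $ k)) = f k * a"
  by (simp add: mat_def if_distrib [of "\<lambda>x. _ * x"] if_distrib [of "\<lambda>x. x * _"] cong: if_cong)

text \<open>The factor \<open>A\<close> acts on indices that are not summed over, so it passes
  through the partial trace.\<close>

lemma partial_trace_tensor_mul_left: "partial_trace_snd ((A \<otimes> mat 1) ** B) = A ** partial_trace_snd B"
  by (simp add: vec_eq_iff matrix_mul_nth partial_trace_nth sum_UNIV_prod tensor_nth sum_mat_1_left
      sum_distrib_left) (intro allI sum.swap)

lemma partial_trace_tensor_mul_right: "partial_trace_snd (B ** (A \<otimes> mat 1)) = partial_trace_snd B ** A"
  by (simp add: vec_eq_iff matrix_mul_nth partial_trace_nth sum_UNIV_prod tensor_nth sum_mat_1_right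
      sum_distrib_right) (intro allI sum.swap)

text \<open>Operators on the traced-out factor still move cyclically: once the identity on the first
  factor is contracted, both sides are the same double sum up to the names of \<open>k\<close> and
  \<open>l\<close>.\<close>

lemma partial_trace_tensor_cyclic:
  "partial_trace_snd ((mat 1 \<otimes> L) ** B) = partial_trace_snd (B ** (mat 1 \<otimes> L))"
proof -
  have "(\<Sum>k\<in>UNIV. \<Sum>a\<in>UNIV. \<Sum>l\<in>UNIV. (mat 1 :: 'a op) $ i $ a * L $ k $ l * B $ (a, l) $ (j, k))
      = (\<Sum>k\<in>UNIV. \<Sum>a\<in>UNIV. \<Sum>l\<in>UNIV. B $ (i, k) $ (a, l) * ((mat 1 :: 'a op) $ a $ j * L $ l $ k))"
    (is "?l = ?r") for i j
  proof -
    have "?l = (\<Sum>k\<in>UNIV. \<Sum>l\<in>UNIV. \<Sum>a\<in>UNIV. L $ k $ l * (mat 1 :: 'a op) $ i $ a * B $ (a, l) $ (j, k))"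
      by (subst (2) sum.swap) (simp add: mult_ac)
    also have "\<dots> = (\<Sum>k\<in>UNIV. \<Sum>l\<in>UNIV. L $ k $ l * B $ (i, l) $ (j, k))"
      by (simp add: sum_mat_1_left)
    also have "\<dots> = (\<Sum>l\<in>UNIV. \<Sum>k\<in>UNIV. L $ k $ l * B $ (i, l) $ (j, k))"
      by (rule sum.swap)
    also have "\<dots> = (\<Sum>k\<in>UNIV. \<Sum>l\<in>UNIV. B $ (i, k) $ (j, l) * L $ l $ k)"
      by (simp add: mult_ac)
    also have "\<dots> = (\<Sum>k\<in>UNIV. \<Sum>l\<in>UNIV. \<Sum>a\<in>UNIV. B $ (i, k) $ (a, l) * (L $ l $ k * (mat 1 :: 'a op) $ a $ j))"
      by (simp add: sum_mat_1_right)
    also have "\<dots> = ?r"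
      by (subst (2) sum.swap) (simp add: mult_ac)
    finally show ?thesis .
  qed
  then show ?thesis
    by (simp add: vec_eq_iff matrix_mul_nth partial_trace_nth sum_UNIV_prod tensor_nth)
qed

lemma partial_trace_tensor: "partial_trace_snd (A \<otimes> B) = mat (trace B) ** A"
  by (simp add: vec_eq_iff mat_scalar_mul_nth partial_trace_nth tensor_nth trace_def sum_distrib_left
      sum_distrib_right mult_ac)

lemma trace_partial_trace: "trace (partial_trace_snd A) = trace A"
  by (simp add: trace_def partial_trace_nth sum_UNIV_prod)

text \<open>The map from \<open>A\<close> to \<open>A \<otimes> mat 1\<close> is dual to the partial
  trace under the trace form. This turns a functional of the partial trace into a pairing with some
  \<open>W \<otimes> mat 1\<close>.\<close>

lemma trace_tensor_mul: "trace ((A \<otimes> mat 1) ** B) = trace (A ** partial_trace_snd B)"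
  by (metis trace_partial_trace partial_trace_tensor_mul_left)

lemma partial_trace_0 [simp]: "partial_trace_snd 0 = 0"
  by (simp add: vec_eq_iff partial_trace_nth)

lemma partial_trace_add: "partial_trace_snd (A + B) = partial_trace_snd A + partial_trace_snd B"
  by (simp add: vec_eq_iff partial_trace_nth sum.distrib)

lemma partial_trace_diff: "partial_trace_snd (A - B) = partial_trace_snd A - partial_trace_snd B"
  by (simp add: vec_eq_iff partial_trace_nth sum_subtractf)

lemma partial_trace_scaleR: "partial_trace_snd (c *\<^sub>R A) = c *\<^sub>R partial_trace_snd A"
  by (simp add: vec_eq_iff partial_trace_nth scaleR_sum_right)

lemma partial_trace_sum: "partial_trace_snd (\<Sum>i\<in>I. A i) = (\<Sum>i\<in>I. partial_trace_snd (A i))"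
  by (simp add: vec_eq_iff partial_trace_nth) (intro allI sum.swap)

lemma partial_trace_mat_scalar_mul: "partial_trace_snd (mat c ** A) = mat c ** partial_trace_snd A"
  by (simp add: vec_eq_iff mat_scalar_mul_nth partial_trace_nth sum_distrib_left)

lemma partial_trace_adj: "partial_trace_snd (adj A) = adj (partial_trace_snd A)"
  by (simp add: vec_eq_iff adj_def partial_trace_nth)

section \<open>Inner products and quadratic forms\<close>

lemma cinner_adj: "cinner v (A *v w) = cinner (adj A *v v) w"
proof -
  have "cinner v (A *v w) = (\<Sum>i\<in>UNIV. \<Sum>j\<in>UNIV. cnj (v $ i) * A $ i $ j * w $ j)"
    by (simp add: cinner_def matrix_vector_mult_def sum_distrib_left mult_ac)
  also have "\<dots> = (\<Sum>j\<in>UNIV. \<Sum>i\<in>UNIV. cnj (v $ i) * A $ i $ j * w $ j)"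
    by (rule sum.swap)
  also have "\<dots> = cinner (adj A *v v) w"
    by (simp add: cinner_def matrix_vector_mult_def adj_def sum_distrib_left mult_ac)
  finally show ?thesis .
qed

lemma cinner_self: "cinner v v = of_real ((norm v)\<^sup>2)"
  by (simp add: cinner_def norm_vec_def L2_set_def sum_nonneg complex_norm_square mult.commute [of "cnj _"]
      del: of_real_power)

lemma cinner_add_right: "cinner v (u + w) = cinner v u + cinner v w"
  by (simp add: cinner_def algebra_simps sum.distrib)

lemma cinner_scaleR_right: "cinner v (c *\<^sub>R w) = c *\<^sub>R cinner v w"
  by (simp add: cinner_def scaleR_sum_right)

text \<open>A crude constant suffices: every coordinate of \<open>v\<close> has modulus at most
  \<open>norm v\<close>. The bound fixes how much of \<open>P\<close> must be added to a Hermitian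
  operator to make it positive.\<close>

lemma quadratic_form_bound:
  "\<bar>Re (cinner v (A *v v))\<bar> \<le> (\<Sum>i\<in>UNIV. \<Sum>j\<in>UNIV. cmod (A $ i $ j)) * (norm v)\<^sup>2"
proof -
  have "cinner v (A *v v) = (\<Sum>i\<in>UNIV. \<Sum>j\<in>UNIV. cnj (v $ i) * (A $ i $ j * v $ j))"
    by (simp add: cinner_def matrix_vector_mult_def sum_distrib_left)
  then have "\<bar>Re (cinner v (A *v v))\<bar> \<le> cmod (\<Sum>i\<in>UNIV. \<Sum>j\<in>UNIV. cnj (v $ i) * (A $ i $ j * v $ j))"
    by (metis abs_Re_le_cmod)
  also have "\<dots> \<le> (\<Sum>i\<in>UNIV. \<Sum>j\<in>UNIV. cmod (A $ i $ j) * (norm v)\<^sup>2)"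
  proof (intro sum_norm_le)
    fix i j
    have "cmod (v $ i) * cmod (v $ j) \<le> norm v * norm v"
      by (intro mult_mono) (auto simp: Finite_Cartesian_Product.norm_nth_le)
    then have "cmod (A $ i $ j) * (cmod (v $ i) * cmod (v $ j)) \<le> cmod (A $ i $ j) * (norm v * norm v)"
      by (rule mult_left_mono) simp
    then show "cmod (cnj (v $ i) * (A $ i $ j * v $ j)) \<le> cmod (A $ i $ j) * (norm v)\<^sup>2"
      by (simp add: norm_mult power2_eq_square mult_ac)
  qed
  also have "\<dots> = (\<Sum>i\<in>UNIV. \<Sum>j\<in>UNIV. cmod (A $ i $ j)) * (norm v)\<^sup>2"
    by (simp add: sum_distrib_right)
  finally show ?thesis .
qed


section \<open>Products with sums of elementary tensors\<close>

lemma tensor_sum_mul_right: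
  "(\<Sum>k\<in>I. A k \<otimes> B k) ** (C \<otimes> D) = (\<Sum>k\<in>I. (A k ** C) \<otimes> (B k ** D))"
  by (simp add: matrix_mul_sum_left tensor_mul)

lemma tensor_sum_mul_left:
  "(C \<otimes> D) ** (\<Sum>k\<in>I. A k \<otimes> B k) = (\<Sum>k\<in>I. (C ** A k) \<otimes> (D ** B k))"
  by (simp add: matrix_mul_sum_right tensor_mul)

lemma tensor_0_left [simp]: "0 \<otimes> A = 0"
  by (simp add: vec_eq_iff tensor_op_def)

lemma tensor_0_right [simp]: "A \<otimes> 0 = 0"
  by (simp add: vec_eq_iff tensor_op_def)

section \<open>Causality and operators with vanishing partial trace\<close>

text \<open>The states \<open>\<rho>\<close> and \<open>\<sigma>\<close> below differ by
  \<open>r *\<^sub>R H\<close>, so \<open>ker\<close> gives them equal partial traces; causality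
  equates their outputs, and linearity leaves the output of \<open>H\<close>.\<close>

lemma Tr_YZ_hermitian_kernel:
  assumes P: "projection P" and causal: "causal_Y_to_X U (im P)"
    and herm: "adj H = H" and supp: "P ** H ** P = H" and ker: "Tr_Z H = 0"
  shows "Tr_YZ (U ** H ** adj U) = 0"
proof (cases "P = 0")
  \<comment> \<open>The image of \<open>P = 0\<close> carries no state, so causality says nothing
    here and the case is separate.\<close>
  case True
  then have "H = 0" using supp by simp
  then show ?thesis
    by (simp add: Tr_YZ_def)
next
  case False
  with P obtain t where t: "trace P = of_real t" "t > 0"
    using trace_projection by blast
  \<comment> \<open>The entry sum dominates the quadratic form of \<open>H\<close>, so
    \<open>H + c *\<^sub>R P\<close> is positive semidefinite; the summand 1 keeps \<open>c\<close>
    positive when \<open>H = 0\<close>.\<close>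
  define c where "c = 1 + (\<Sum>i\<in>UNIV. \<Sum>j\<in>UNIV. cmod (H $ i $ j))"
  have c: "c > 0" unfolding c_def by (simp add: sum_nonneg add_pos_nonneg)
  \<comment> \<open>\<open>c * t\<close> is the trace of \<open>c *\<^sub>R P\<close>, and
    \<open>H\<close> is traceless, so \<open>r\<close> normalizes both operators.\<close>
  define r where "r = inverse (c * t)"
  have r: "r > 0" using c t by (simp add: r_def)
  define \<rho> where "\<rho> = r *\<^sub>R (H + c *\<^sub>R P)"
  define \<sigma> where "\<sigma> = r *\<^sub>R (c *\<^sub>R P)"
  have PP: "P ** P = P" and adjP: "adj P = P" using P by (simp_all add: projection_def)
  have PH: "P ** H = H" using supp by (metis PP matrix_mul_assoc)
  have quadP: "Re (cinner v (P *v v)) = (norm (P *v v))\<^sup>2" for v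
  proof -
    have "cinner v (P *v v) = cinner (P *v v) (P *v v)"
      by (metis PP adjP cinner_adj matrix_vector_mul_assoc)
    then show ?thesis by (simp add: cinner_self)
  qed
  \<comment> \<open>Since \<open>H = P ** H ** P\<close>, its form depends only on
    \<open>P *v v\<close>. The bound has to use this vector, as the form of
    \<open>c *\<^sub>R P\<close> offers only \<open>c\<close> times its squared norm.\<close>
  have quadH: "- (c * (norm (P *v v))\<^sup>2) \<le> Re (cinner v (H *v v))" for v
  proof -
    have "cinner v (H *v v) = cinner (P *v v) (H *v (P *v v))"
      by (metis supp adjP cinner_adj matrix_vector_mul_assoc)
    moreover have "\<bar>Re (cinner (P *v v) (H *v (P *v v)))\<bar> \<le> (c - 1) * (norm (P *v v))\<^sup>2"
      unfolding c_def using quadratic_form_bound [of "P *v v" H] by simp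
    moreover have "(c - 1) * (norm (P *v v))\<^sup>2 \<le> c * (norm (P *v v))\<^sup>2"
      by (simp add: mult_right_mono)
    ultimately show ?thesis by (simp only: abs_le_iff) linarith
  qed
  have scaleR_mulv: "(a *\<^sub>R A) *v v = a *\<^sub>R (A *v v)" for a and A :: "(('a \<times> 'b) \<times> 'c) op" and v
    by (simp add: vec_eq_iff matrix_vector_mult_def scaleR_sum_right)
  have "0 \<le> Re (cinner v (\<rho> *v v))" for v
  proof -
    have "Re (cinner v (\<rho> *v v)) = r * (Re (cinner v (H *v v)) + c * (norm (P *v v))\<^sup>2)"
      by (simp add: \<rho>_def scaleR_mulv matrix_vector_mult_add_rdistrib cinner_scaleR_right
          cinner_add_right quadP)
    then show ?thesis using quadH [of v] r by simp
  qed
  then have psd\<rho>: "positive_semidefinite \<rho>"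
    by (simp add: positive_semidefinite_def \<rho>_def adj_scaleR adj_add herm adjP)
  have "0 \<le> Re (cinner v (\<sigma> *v v))" for v
    using c r by (simp add: \<sigma>_def scaleR_mulv cinner_scaleR_right quadP)
  then have psd\<sigma>: "positive_semidefinite \<sigma>"
    by (simp add: positive_semidefinite_def \<sigma>_def adj_scaleR adjP)
  have tr\<sigma>: "trace \<sigma> = 1"
    using c t by (simp add: \<sigma>_def trace_scaleR r_def scaleR_conv_of_real [where 'a = complex] field_simps)
  have "trace H = trace (Tr_Z H)" by (simp add: Tr_Z_def trace_partial_trace)
  then have "trace H = 0" by (simp add: ker trace_def)
  then have "trace \<rho> = trace \<sigma>" by (simp add: \<rho>_def \<sigma>_def trace_scaleR trace_add)
  with psd\<rho> psd\<sigma> tr\<sigma> have dens: "density_operator \<rho>" "density_operator \<sigma>"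
    by (simp_all add: density_operator_def)
  have "P ** \<rho> = \<rho>" "P ** \<sigma> = \<sigma>"
    by (simp_all add: \<rho>_def \<sigma>_def matrix_scalar_ac scalar_matrix_assoc [symmetric]
        matrix_add_ldistrib PP PH scaleR_add_right mult.commute)
  then have im: "im \<rho> \<subseteq> im P" "im \<sigma> \<subseteq> im P"
    unfolding im_def image_subset_iff by (metis matrix_vector_mul_assoc rangeI)+
  have "Tr_Z \<rho> = Tr_Z \<sigma>"
    using ker by (simp add: Tr_Z_def \<rho>_def \<sigma>_def partial_trace_scaleR partial_trace_add)
  with causal dens im have "Tr_YZ (U ** \<rho> ** adj U) = Tr_YZ (U ** \<sigma> ** adj U)"
    unfolding causal_Y_to_X_def by blast
  then have "r *\<^sub>R Tr_YZ (U ** H ** adj U) = 0"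
    by (simp add: \<rho>_def \<sigma>_def Tr_YZ_def matrix_scalar_ac scalar_matrix_assoc [symmetric]
        matrix_add_ldistrib matrix_add_rdistrib partial_trace_scaleR partial_trace_add scaleR_add_right)
  with r show ?thesis by simp
qed

text \<open>The Hermitian operators \<open>A + adj A\<close> and
  \<open>mat \<i> ** (A - adj A)\<close> inherit the support and the vanishing partial trace. The
  first shows that the outputs of \<open>A\<close> and \<open>adj A\<close> are opposite, the second
  that they are equal.\<close>

lemma Tr_YZ_kernel:
  assumes P: "projection P" and causal: "causal_Y_to_X U (im P)"
    and supp: "P ** A ** P = A" and ker: "Tr_Z A = 0"
  shows "Tr_YZ (U ** A ** adj U) = 0"
proof -
  have adjP: "adj P = P" using P by (simp add: projection_def)
  have supp': "P ** adj A ** P = adj A"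
    using arg_cong [OF supp, of adj] by (simp add: adj_mul adjP matrix_mul_assoc)
  have ker': "Tr_Z (adj A) = 0"
    using ker by (simp add: Tr_Z_def partial_trace_adj) (simp add: adj_def vec_eq_iff)
  have re: "Tr_YZ (U ** (A + adj A) ** adj U) = 0"
  proof (rule Tr_YZ_hermitian_kernel [OF P causal])
    show "adj (A + adj A) = A + adj A" by (simp add: adj_add)
    show "P ** (A + adj A) ** P = A + adj A"
      by (simp add: matrix_add_ldistrib matrix_add_rdistrib supp supp')
    show "Tr_Z (A + adj A) = 0"
      using ker ker' by (simp add: Tr_Z_def partial_trace_add)
  qed
  have im: "Tr_YZ (U ** (mat \<i> ** (A - adj A)) ** adj U) = 0"
  proof (rule Tr_YZ_hermitian_kernel [OF P causal])
    show "adj (mat \<i> ** (A - adj A)) = mat \<i> ** (A - adj A)"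
      by (simp add: adj_mat_scalar_mul adj_diff) (simp add: vec_eq_iff mat_scalar_mul_nth algebra_simps)
    show "P ** (mat \<i> ** (A - adj A)) ** P = mat \<i> ** (A - adj A)"
      by (simp add: mat_scalar_mul_commute matrix_mul_assoc [symmetric, of "mat \<i>"])
        (simp add: matrix_mul_diff_left matrix_mul_diff_right supp supp')
    show "Tr_Z (mat \<i> ** (A - adj A)) = 0"
      using ker ker' by (simp add: Tr_Z_def partial_trace_mat_scalar_mul partial_trace_diff)
  qed
  have "mat \<i> ** Tr_YZ (U ** (A - adj A) ** adj U) = 0"
    using im by (simp add: mat_scalar_mul_commute matrix_mul_assoc [symmetric, of "mat \<i>"]
        Tr_YZ_def partial_trace_mat_scalar_mul)
  then have "Tr_YZ (U ** (A - adj A) ** adj U) = 0"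
    by (simp add: vec_eq_iff mat_scalar_mul_nth)
  with re have "Tr_YZ (U ** A ** adj U) + Tr_YZ (U ** adj A ** adj U) = 0"
    "Tr_YZ (U ** A ** adj U) = Tr_YZ (U ** adj A ** adj U)"
    by (simp_all add: Tr_YZ_def matrix_add_ldistrib matrix_add_rdistrib matrix_mul_diff_left
        matrix_mul_diff_right partial_trace_add partial_trace_diff)
  then have "2 *\<^sub>R Tr_YZ (U ** A ** adj U) = 0" by (simp add: scaleR_2)
  then show ?thesis by simp
qed

section \<open>Orthogonal families of projections and block-diagonal operators\<close>

text \<open>Stated for an arbitrary family because it is instantiated three times: by \<Delta>, by
  \<Lambda> and by the products \<open>\<Delta> k \<otimes> \<Lambda> k\<close>.\<close>

locale orthogonal_projections =
  fixes Q :: "'i \<Rightarrow> 'a::finite op" and I :: "'i set"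
  assumes finite_index: "finite I"
    and proj: "k \<in> I \<Longrightarrow> projection (Q k)"
    and orth: "j \<in> I \<Longrightarrow> k \<in> I \<Longrightarrow> j \<noteq> k \<Longrightarrow> Q j ** Q k = 0"
begin

lemma adj_proj: "k \<in> I \<Longrightarrow> adj (Q k) = Q k"
  using proj by (simp add: projection_def)

lemma idem: "k \<in> I \<Longrightarrow> Q k ** Q k = Q k"
  using proj by (simp add: projection_def)

lemma mul_sum_proj:
  assumes "j \<in> I"
  shows "Q j ** (\<Sum>k\<in>I. Q k ** R k) = Q j ** R j"
proof -
  have "Q j ** (\<Sum>k\<in>I. Q k ** R k) = (\<Sum>k\<in>I. Q j ** Q k ** R k)"
    by (simp add: matrix_mul_sum_right matrix_mul_assoc)
  also have "\<dots> = (\<Sum>k\<in>I. if k = j then Q j ** R j else 0)"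
    using assms orth by (intro sum.cong) (auto simp: idem)
  finally show ?thesis using assms finite_index by simp
qed

lemma sum_proj_mul:
  assumes "j \<in> I"
  shows "(\<Sum>k\<in>I. R k ** Q k) ** Q j = R j ** Q j"
proof -
  have "(\<Sum>k\<in>I. R k ** Q k) ** Q j = (\<Sum>k\<in>I. R k ** (Q k ** Q j))"
    by (simp add: matrix_mul_sum_left matrix_mul_assoc)
  also have "\<dots> = (\<Sum>k\<in>I. if k = j then R j ** Q j else 0)"
    using assms orth by (intro sum.cong) (auto simp: idem)
  finally show ?thesis using assms finite_index by simp
qed

lemma projection_sum: "projection (\<Sum>k\<in>I. Q k)"
proof -
  \<comment> \<open>The trivial factor \<open>mat 1\<close> brings the inner sum into the shape
    needed by \<open>mul_sum_proj\<close>.\<close>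
  have "(\<Sum>k\<in>I. Q k) ** (\<Sum>k\<in>I. Q k) = (\<Sum>j\<in>I. Q j ** (\<Sum>k\<in>I. Q k ** mat 1))"
    by (simp add: matrix_mul_sum_left)
  also have "\<dots> = (\<Sum>j\<in>I. Q j)"
    by (intro sum.cong refl) (simp add: mul_sum_proj del: matrix_mul_rid, simp)
  finally show ?thesis
    by (simp add: projection_def adj_sum adj_proj)
qed

text \<open>Only the corners of the \<open>V k\<close> enter, so these may be any operators on the
  whole space. The result vanishes on the complement of the images of the \<open>Q k\<close>, so it
  is unitary at most on their sum.\<close>

definition block :: "('i \<Rightarrow> 'a op) \<Rightarrow> 'a op"
  where "block V = (\<Sum>k\<in>I. Q k ** V k ** Q k)"

lemma mul_block: "j \<in> I \<Longrightarrow> Q j ** block V = Q j ** V j ** Q j"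
  using mul_sum_proj [of j "\<lambda>k. V k ** Q k"] by (simp add: block_def matrix_mul_assoc)

lemma block_mul: "j \<in> I \<Longrightarrow> block V ** Q j = Q j ** V j ** Q j"
  using sum_proj_mul [of j "\<lambda>k. Q k ** V k"] by (simp add: block_def)

lemma sum_mul_block: "(\<Sum>k\<in>I. Q k) ** block V = block V"
  by (simp add: matrix_mul_sum_left mul_block) (simp add: block_def)

lemma block_mul_sum: "block V ** (\<Sum>k\<in>I. Q k) = block V"
  by (simp add: matrix_mul_sum_right block_mul) (simp add: block_def)

end

section \<open>The correlated projection and compressions to its image\<close>

text \<open>That \<open>\<Lambda> k\<close> is nonzero enters through its positive trace, by which
  the construction of \<open>W\<close> and the cancellation of the second tensor factor
  divide.\<close>

locale correlated_projections =
  left: orthogonal_projections \<Delta> I + right: orthogonal_projections \<Lambda> I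
  for \<Delta> :: "'i \<Rightarrow> 'a::finite op" and \<Lambda> :: "'i \<Rightarrow> 'b::finite op" and I +
  fixes P :: "('a \<times> 'b) op"
  assumes nonzero: "k \<in> I \<Longrightarrow> \<Lambda> k \<noteq> 0"
    and P_def: "P = (\<Sum>k\<in>I. \<Delta> k \<otimes> \<Lambda> k)"
begin

sublocale joint: orthogonal_projections "\<lambda>k. \<Delta> k \<otimes> \<Lambda> k" I
  by unfold_locales
    (auto simp: left.finite_index projection_def adj_tensor tensor_mul left.adj_proj right.adj_proj
      left.idem right.idem left.orth)

lemma projection_P: "projection P"
  unfolding P_def by (rule joint.projection_sum)

lemma adj_P: "adj P = P" and P_idem: "P ** P = P"
  using projection_P by (simp_all add: projection_def)

lemma mul_P_P: "A ** P ** P = A ** P"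
  by (simp add: matrix_mul_assoc [symmetric] P_idem)

lemma P_mul_slice:
  assumes "k \<in> I"
  shows "P ** (mat 1 \<otimes> \<Lambda> k) = \<Delta> k \<otimes> \<Lambda> k"
proof -
  have "P ** (mat 1 \<otimes> \<Lambda> k) = (\<Sum>j\<in>I. \<Delta> j \<otimes> (\<Lambda> j ** \<Lambda> k))"
    by (simp add: P_def tensor_sum_mul_right)
  also have "\<dots> = (\<Sum>j\<in>I. if j = k then \<Delta> k \<otimes> \<Lambda> k else 0)"
    using assms right.orth by (intro sum.cong) (auto simp: right.idem)
  finally show ?thesis using assms left.finite_index by simp
qed

text \<open>Cutting with \<open>mat 1 \<otimes> \<Lambda> k\<close> isolates the \<open>k\<close>-th
  summand of \<open>P\<close>; the partial trace then turns \<open>\<Lambda> k\<close> into a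
  nonzero scalar that cancels.\<close>

lemma tensor_fix_P:
  assumes "(Y \<otimes> mat 1) ** P = P" and "k \<in> I"
  shows "Y ** \<Delta> k = \<Delta> k"
proof -
  have "(Y \<otimes> mat 1) ** (P ** (mat 1 \<otimes> \<Lambda> k)) = P ** (mat 1 \<otimes> \<Lambda> k)"
    using assms(1) by (simp add: matrix_mul_assoc)
  then have "(Y ** \<Delta> k) \<otimes> \<Lambda> k = \<Delta> k \<otimes> \<Lambda> k"
    by (simp add: P_mul_slice [OF assms(2)] tensor_mul)
  then have "mat (trace (\<Lambda> k)) ** (Y ** \<Delta> k) = mat (trace (\<Lambda> k)) ** \<Delta> k"
    by (metis partial_trace_tensor)
  moreover have "trace (\<Lambda> k) \<noteq> 0"
    using trace_projection [OF right.proj [OF assms(2)]] nonzero [OF assms(2)]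
    by (metis of_real_eq_0_iff less_irrefl)
  ultimately show ?thesis
    by (simp add: vec_eq_iff mat_scalar_mul_nth)
qed

text \<open>Both products collapse to the sum of
  \<open>(\<Delta> k ** V k ** \<Delta> k) \<otimes> \<Lambda> k\<close>.\<close>

lemma block_commutes_P: "(left.block V \<otimes> mat 1) ** P = P ** (left.block V \<otimes> mat 1)"
  by (simp add: P_def tensor_sum_mul_left tensor_sum_mul_right left.mul_block left.block_mul)

text \<open>Expand \<open>P ** B ** P\<close> over pairs \<open>j\<close>, \<open>k\<close>. Under
  the partial trace the \<Delta> factors come out on either side, while cyclicity merges the
  \<Lambda> factors into \<open>\<Lambda> k ** \<Lambda> j\<close>, which kills the terms off the
  diagonal.\<close>

lemma partial_trace_block:
  assumes "P ** B ** P = B"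
  shows "partial_trace_snd B = left.block (\<lambda>k. partial_trace_snd (B ** (mat 1 \<otimes> \<Lambda> k)))"
proof -
  have split: "\<Delta> k \<otimes> \<Lambda> k = (\<Delta> k \<otimes> mat 1) ** (mat 1 \<otimes> \<Lambda> k)" "\<Delta> k \<otimes> \<Lambda> k = (mat 1 \<otimes> \<Lambda> k) ** (\<Delta> k \<otimes> mat 1)" for k
    by (simp_all add: tensor_mul)
  have summand: "partial_trace_snd ((\<Delta> j \<otimes> \<Lambda> j) ** B ** (\<Delta> k \<otimes> \<Lambda> k))
      = (if j = k then \<Delta> k ** partial_trace_snd (B ** (mat 1 \<otimes> \<Lambda> k)) ** \<Delta> k else 0)"
    if "j \<in> I" "k \<in> I" for j k
  proof -
    have "partial_trace_snd ((\<Delta> j \<otimes> \<Lambda> j) ** B ** (\<Delta> k \<otimes> \<Lambda> k))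
      = partial_trace_snd ((\<Delta> j \<otimes> mat 1) ** (((mat 1 \<otimes> \<Lambda> j) ** (B ** (mat 1 \<otimes> \<Lambda> k))) ** (\<Delta> k \<otimes> mat 1)))"
      by (subst split(1) [of j], subst split(2) [of k]) (simp only: matrix_mul_assoc)
    also have "\<dots> = \<Delta> j ** (partial_trace_snd (B ** (mat 1 \<otimes> \<Lambda> k) ** (mat 1 \<otimes> \<Lambda> j)) ** \<Delta> k)"
      by (simp only: partial_trace_tensor_mul_left partial_trace_tensor_mul_right
          partial_trace_tensor_cyclic)
    also have "B ** (mat 1 \<otimes> \<Lambda> k) ** (mat 1 \<otimes> \<Lambda> j) = B ** (mat 1 \<otimes> (\<Lambda> k ** \<Lambda> j))"
      by (simp add: matrix_mul_assoc [symmetric] tensor_mul)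
    finally show ?thesis
      using that right.orth [of k j]
      by (auto simp: right.idem matrix_mul_assoc)
  qed
  have "partial_trace_snd B = partial_trace_snd (P ** B ** P)" using assms by simp
  also have "\<dots> = (\<Sum>k\<in>I. \<Sum>j\<in>I. partial_trace_snd ((\<Delta> j \<otimes> \<Lambda> j) ** B ** (\<Delta> k \<otimes> \<Lambda> k)))"
    by (simp add: P_def matrix_mul_sum_left matrix_mul_sum_right partial_trace_sum)
  also have "\<dots> = (\<Sum>k\<in>I. \<Sum>j\<in>I. if j = k then \<Delta> k ** partial_trace_snd (B ** (mat 1 \<otimes> \<Lambda> k)) ** \<Delta> k else 0)"
    by (intro sum.cong refl) (simp add: summand)
  finally show ?thesis
    by (simp add: left.block_def left.finite_index)
qed

text \<open>The hypothesis lets \<open>trace (M ** B)\<close> be evaluated at any supported operator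
  with the partial trace of \<open>B\<close>; a sum of elementary tensors with the
  \<open>\<Lambda> k\<close> makes the block operator visible.\<close>

lemma compression_is_block:
  assumes kernel: "\<And>A. P ** A ** P = A \<Longrightarrow> partial_trace_snd A = 0 \<Longrightarrow> trace (M ** A) = 0"
  obtains V where "P ** M ** P = P ** (left.block V \<otimes> mat 1) ** P"
proof -
  have "\<exists>t. trace (\<Lambda> k) = of_real t \<and> t > 0" if "k \<in> I" for k
    using trace_projection [OF right.proj [OF that]] nonzero [OF that] by metis
  then obtain t where t: "\<And>k. k \<in> I \<Longrightarrow> trace (\<Lambda> k) = of_real (t k)" "\<And>k. k \<in> I \<Longrightarrow> t k > 0"
    by metis
  \<comment> \<open>\<open>V k\<close> is \<open>M\<close> partially traced against the normalized
    projection \<open>\<Lambda> k\<close>, so pairing it with an operator \<open>S\<close> gives the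
    value of the functional at \<open>S \<otimes> \<Lambda> k\<close> divided by
    \<open>t k\<close>.\<close>
  define V where "V k = inverse (t k) *\<^sub>R partial_trace_snd (M ** (mat 1 \<otimes> \<Lambda> k))" for k
  let ?W = "left.block V"
  have eq: "trace (M ** B) = trace ((?W \<otimes> mat 1) ** B)" if B: "P ** B ** P = B" for B
  proof -
    define R where "R k = partial_trace_snd (B ** (mat 1 \<otimes> \<Lambda> k))" for k
    have ptB: "partial_trace_snd B = left.block R"
      using partial_trace_block [OF B] by (simp add: R_def [abs_def])
    define S where "S k = \<Delta> k ** R k ** \<Delta> k" for k
    \<comment> \<open>The weight \<open>inverse (t k)\<close> undoes the factor
      \<open>trace (\<Lambda> k)\<close> produced by the partial trace, so that \<open>C\<close> and
      \<open>B\<close> have equal partial traces.\<close>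
    define C where "C = (\<Sum>k\<in>I. inverse (t k) *\<^sub>R (S k \<otimes> \<Lambda> k))"
    have "P ** (S k \<otimes> \<Lambda> k) ** P = S k \<otimes> \<Lambda> k" if k: "k \<in> I" for k
    proof -
      have "S k \<otimes> \<Lambda> k = (\<Delta> k \<otimes> \<Lambda> k) ** (R k \<otimes> mat 1) ** (\<Delta> k \<otimes> \<Lambda> k)"
        using k by (simp add: S_def tensor_mul right.idem)
      moreover have "P ** (\<Delta> k \<otimes> \<Lambda> k) = \<Delta> k \<otimes> \<Lambda> k"
        using joint.sum_proj_mul [OF k, of "\<lambda>_. mat 1"] by (simp add: P_def)
      moreover have "(\<Delta> k \<otimes> \<Lambda> k) ** P = \<Delta> k \<otimes> \<Lambda> k"
        using joint.mul_sum_proj [OF k, of "\<lambda>_. mat 1"] by (simp add: P_def)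
      ultimately show ?thesis by (metis matrix_mul_assoc)
    qed
    then have C: "P ** C ** P = C"
      by (simp add: C_def matrix_mul_sum_left matrix_mul_sum_right matrix_scalar_ac
          scalar_matrix_assoc [symmetric])
    have "partial_trace_snd C = (\<Sum>k\<in>I. S k)"
      unfolding C_def partial_trace_sum
    proof (intro sum.cong refl)
      fix k assume k: "k \<in> I"
      show "partial_trace_snd (inverse (t k) *\<^sub>R (S k \<otimes> \<Lambda> k)) = S k"
        using t [OF k]
        by (simp add: partial_trace_scaleR partial_trace_tensor vec_eq_iff mat_scalar_mul_nth
            scaleR_conv_of_real [where 'a = complex])
    qed
    then have ptC: "partial_trace_snd C = partial_trace_snd B"
      by (simp add: ptB left.block_def S_def)
    have "trace (M ** (B - C)) = 0"
      by (rule kernel) (simp_all add: matrix_mul_diff_left matrix_mul_diff_right B C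
          partial_trace_diff ptC)
    then have "trace (M ** B) = trace (M ** C)"
      by (simp add: matrix_mul_diff_right trace_sub)
    also have "\<dots> = (\<Sum>k\<in>I. inverse (t k) *\<^sub>R trace (M ** (S k \<otimes> \<Lambda> k)))"
      by (simp add: C_def matrix_mul_sum_right trace_sum matrix_scalar_ac
          scalar_matrix_assoc [symmetric] trace_scaleR)
    also have "\<dots> = (\<Sum>k\<in>I. trace (V k ** S k))"
    proof (intro sum.cong refl)
      fix k
      have "M ** (S k \<otimes> \<Lambda> k) = M ** (mat 1 \<otimes> \<Lambda> k) ** (S k \<otimes> mat 1)"
        by (simp add: matrix_mul_assoc [symmetric] tensor_mul)
      then have "trace (M ** (S k \<otimes> \<Lambda> k)) = trace (partial_trace_snd (M ** (mat 1 \<otimes> \<Lambda> k)) ** S k)"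
        by (metis trace_partial_trace partial_trace_tensor_mul_right)
      then show "inverse (t k) *\<^sub>R trace (M ** (S k \<otimes> \<Lambda> k)) = trace (V k ** S k)"
        by (simp add: V_def scalar_matrix_assoc [symmetric] trace_scaleR)
    qed
    \<comment> \<open>\<open>S k\<close> lives in the \<open>k\<close>-th corner, where
      \<open>V k\<close> and the block operator \<open>?W\<close> have the same compression.\<close>
    also have "\<dots> = (\<Sum>k\<in>I. trace (?W ** S k))"
    proof (intro sum.cong refl)
      fix k assume k: "k \<in> I"
      have "trace (V k ** S k) = trace (V k ** \<Delta> k ** R k ** \<Delta> k)"
        by (simp add: S_def matrix_mul_assoc)
      also have "\<dots> = trace (\<Delta> k ** V k ** \<Delta> k ** R k)"
        by (subst trace_mul_sym) (simp add: matrix_mul_assoc)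
      also have "\<dots> = trace (\<Delta> k ** (?W ** \<Delta> k ** R k))"
        using k by (simp add: left.block_mul matrix_mul_assoc left.idem)
      also have "\<dots> = trace (?W ** S k)"
        by (subst trace_mul_sym) (simp add: S_def matrix_mul_assoc)
      finally show "trace (V k ** S k) = trace (?W ** S k)" .
    qed
    also have "\<dots> = trace (?W ** partial_trace_snd B)"
      by (simp add: ptB left.block_def S_def matrix_mul_sum_right trace_sum)
    finally show ?thesis by (simp add: trace_tensor_mul)
  qed
  have "P ** M ** P = P ** (?W \<otimes> mat 1) ** P"
  proof (rule trace_mul_eqI)
    fix B
    have cyc: "trace (P ** N ** P ** B) = trace (N ** (P ** B ** P))" for N
      using trace_mul_sym [of P "N ** P ** B"] by (simp add: matrix_mul_assoc)
    \<comment> \<open>For arbitrary \<open>B\<close>, cyclicity moves the outer factors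
      \<open>P\<close> onto it, and the compressed operator meets the support condition of
      \<open>eq\<close>.\<close>
    have "P ** (P ** B ** P) ** P = P ** B ** P"
      by (simp add: matrix_mul_assoc P_idem mul_P_P)
    from eq [OF this] show "trace (P ** M ** P ** B) = trace (P ** (?W \<otimes> mat 1) ** P ** B)"
      by (simp only: cyc)
  qed
  with that show ?thesis .
qed

section \<open>Unitarity of the block operator and its extension\<close>

text \<open>As \<open>M\<close> commutes with \<open>P\<close>, the compression \<open>?T\<close>
  equals \<open>M ** P\<close>, so \<open>adj ?T ** ?T = P\<close>. Since also
  \<open>?T = (W \<otimes> mat 1) ** P\<close>, the operator
  \<open>(adj W ** W) \<otimes> mat 1\<close> fixes \<open>P\<close>, and hence
  \<open>adj W ** W\<close> fixes every \<open>\<Delta> k\<close>.\<close>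

lemma block_isometry:
  assumes W: "W = left.block V"
    and M: "P ** M ** P = P ** (W \<otimes> mat 1) ** P"
    and comm: "M ** P = P ** M" and iso: "adj M ** M = mat 1"
  shows "adj W ** W = (\<Sum>k\<in>I. \<Delta> k)"
proof -
  let ?T = "P ** M ** P"
  have adj_comm: "P ** adj M = adj M ** P"
    using arg_cong [OF comm, of adj] by (simp add: adj_mul adj_P)
  have T: "?T = (W \<otimes> mat 1) ** P"
    unfolding M W block_commutes_P [symmetric] by (simp add: matrix_mul_assoc mul_P_P)
  have "adj ?T = P ** (adj W \<otimes> mat 1)"
    unfolding T by (simp add: adj_mul adj_P adj_tensor)
  moreover have "adj ?T = P ** adj M ** P"
    by (simp add: adj_mul adj_P matrix_mul_assoc)
  moreover have "P ** adj M ** P ** ?T = P"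
  proof -
    have "P ** adj M ** P ** ?T = adj M ** (P ** M) ** P"
      by (simp add: adj_comm matrix_mul_assoc mul_P_P)
    also have "\<dots> = adj M ** M ** P"
      by (simp only: comm [symmetric] matrix_mul_assoc mul_P_P)
    finally show ?thesis by (simp add: iso)
  qed
  ultimately have "P ** (adj W \<otimes> mat 1) ** ((W \<otimes> mat 1) ** P) = P"
    using T by simp
  moreover have "P ** (adj W \<otimes> mat 1) = (adj W \<otimes> mat 1) ** P"
    using arg_cong [OF block_commutes_P [of V], of adj]
    by (simp add: W [symmetric] adj_mul adj_P adj_tensor)
  ultimately have "(adj W \<otimes> mat 1) ** (P ** (W \<otimes> mat 1)) ** P = P"
    by (simp add: matrix_mul_assoc)
  then have "((adj W \<otimes> mat 1) ** (W \<otimes> mat 1)) ** P = P"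
    unfolding W block_commutes_P [symmetric] by (simp add: matrix_mul_assoc mul_P_P)
  then have "((adj W ** W) \<otimes> mat 1) ** P = P"
    by (simp add: tensor_mul)
  then have "adj W ** W ** \<Delta> k = \<Delta> k" if "k \<in> I" for k
    using tensor_fix_P that by blast
  then have "adj W ** W ** (\<Sum>k\<in>I. \<Delta> k) = (\<Sum>k\<in>I. \<Delta> k)"
    by (simp add: matrix_mul_sum_right)
  \<comment> \<open>\<open>W\<close> absorbs the sum of the \<open>\<Delta> k\<close> on its right,
    so the left side is \<open>adj W ** W\<close> itself.\<close>
  then show ?thesis
    by (metis W left.block_mul_sum matrix_mul_assoc)
qed

lemma adj_block: "adj (left.block V) = left.block (\<lambda>k. adj (V k))"
  by (simp add: left.block_def adj_sum adj_mul left.adj_proj matrix_mul_assoc)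

text \<open>\<open>W\<close> vanishes on the complement of the image of \<open>D\<close>; adding
  \<open>mat 1 - D\<close> puts the identity there. The compression is unchanged because
  \<open>D ** \<Delta> k = \<Delta> k\<close> makes the new term annihilate
  \<open>P\<close>.\<close>

lemma unitary_extension:
  assumes W: "W = left.block V"
    and M: "P ** M ** P = P ** (W \<otimes> mat 1) ** P"
    and comm: "M ** P = P ** M" and unit: "unitary M"
  obtains W' where "unitary W'" and "P ** M ** P = P ** (W' \<otimes> mat 1) ** P"
proof -
  define D where "D = (\<Sum>k\<in>I. \<Delta> k)"
  define W' where "W' = W + (mat 1 - D)"
  have D: "adj D = D" "D ** D = D"
    using left.projection_sum by (simp_all add: projection_def D_def)
  have WW: "adj W ** W = D"
    using block_isometry [OF W M comm] unit by (simp add: unitary_def D_def)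
  \<comment> \<open>The compression identity, the commutation and the block form all pass to
    adjoints, so \<open>block_isometry\<close> for \<open>adj W\<close> and \<open>adj M\<close>
    supplies the other half, \<open>W ** adj W = D\<close>.\<close>
  have "P ** adj M ** P = P ** (adj W \<otimes> mat 1) ** P"
    using arg_cong [OF M, of adj] by (simp add: adj_mul adj_P adj_tensor matrix_mul_assoc)
  moreover have "adj M ** P = P ** adj M"
    using arg_cong [OF comm, of adj] by (simp add: adj_mul adj_P)
  moreover have adjW: "adj W = left.block (\<lambda>k. adj (V k))" by (simp add: W adj_block)
  ultimately have WW': "W ** adj W = D"
    using block_isometry [of "adj W" _ "adj M"] unit unfolding unitary_def D_def adj_adj by blast
  have mulD: "D ** W = W" "W ** D = W" "D ** adj W = adj W" "adj W ** D = adj W"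
    unfolding D_def adjW by (simp_all add: W left.sum_mul_block left.block_mul_sum)
  have "unitary W'"
    by (simp add: unitary_def W'_def adj_add adj_diff D matrix_add_ldistrib matrix_add_rdistrib
        matrix_mul_diff_left matrix_mul_diff_right mulD WW WW')
  moreover have "((mat 1 - D) \<otimes> mat 1) ** P = 0"
  proof -
    have "D ** \<Delta> k = \<Delta> k" if "k \<in> I" for k
      using left.sum_proj_mul [OF that, of "\<lambda>_. mat 1"] by (simp add: D_def)
    then show ?thesis
      by (simp add: P_def tensor_sum_mul_left matrix_mul_diff_left)
  qed
  then have "(W' \<otimes> mat 1) ** P = (W \<otimes> mat 1) ** P"
    by (simp add: W'_def tensor_add_left matrix_add_rdistrib)
  then have "P ** M ** P = P ** (W' \<otimes> mat 1) ** P"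
    unfolding M by (simp add: matrix_mul_assoc [symmetric])
  ultimately show ?thesis using that by blast
qed

end

section \<open>Factorization for a causal unitary\<close>

theorem theorem4:
  fixes \<Delta> :: "nat \<Rightarrow> ('x::finite \<times> 'y::finite) op"
    and \<Lambda> :: "nat \<Rightarrow> 'z::finite op"
    and P U :: "(('x \<times> 'y) \<times> 'z) op"
    and n :: nat
  assumes "\<And>k. k \<in> {1..n} \<Longrightarrow> projection (\<Delta> k) \<and> \<Delta> k \<noteq> 0"
    and "\<And>j k. j \<in> {1..n} \<Longrightarrow> k \<in> {1..n} \<Longrightarrow> j \<noteq> k \<Longrightarrow> \<Delta> j ** \<Delta> k = 0"
    and "\<And>k. k \<in> {1..n} \<Longrightarrow> projection (\<Lambda> k) \<and> \<Lambda> k \<noteq> 0"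
    and "\<And>j k. j \<in> {1..n} \<Longrightarrow> k \<in> {1..n} \<Longrightarrow> j \<noteq> k \<Longrightarrow> \<Lambda> j ** \<Lambda> k = 0"
    and "P = (\<Sum>k=1..n. \<Delta> k \<otimes> \<Lambda> k)"
    and "unitary U"
    and "causal_Y_to_X U (im P)"
  shows "\<forall>X :: 'x op.
    (\<exists>W :: ('x \<times> 'y) op.
      P ** adj U ** (X \<otimes> (mat 1 :: 'y op) \<otimes> (mat 1 :: 'z op)) ** U ** P
        = P ** (W \<otimes> (mat 1 :: 'z op)) ** P) \<and>
    (unitary X \<and>
     (adj U ** (X \<otimes> (mat 1 :: 'y op) \<otimes> (mat 1 :: 'z op)) ** U) ** P
       = P ** (adj U ** (X \<otimes> (mat 1 :: 'y op) \<otimes> (mat 1 :: 'z op)) ** U) \<longrightarrow>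
     (\<exists>W :: ('x \<times> 'y) op. unitary W \<and>
      P ** adj U ** (X \<otimes> (mat 1 :: 'y op) \<otimes> (mat 1 :: 'z op)) ** U ** P
        = P ** (W \<otimes> (mat 1 :: 'z op)) ** P))"
proof (intro allI)
  fix X :: "'x op"
  interpret correlated_projections \<Delta> \<Lambda> "{1..n}" P
    using assms by unfold_locales auto
  define X' where "X' = X \<otimes> (mat 1 :: 'y op) \<otimes> (mat 1 :: 'z op)"
  define M where "M = adj U ** X' ** U"
  have PMP: "P ** adj U ** X' ** U ** P = P ** M ** P"
    by (simp add: M_def matrix_mul_assoc)
  obtain V where V: "P ** M ** P = P ** (left.block V \<otimes> mat 1) ** P"
  proof (rule compression_is_block)
    fix A assume "P ** A ** P = A" "partial_trace_snd A = 0"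
    then have "Tr_YZ (U ** A ** adj U) = 0"
      using Tr_YZ_kernel [OF projection_P assms(7)] by (simp add: Tr_Z_def)
    \<comment> \<open>Cyclicity moves \<open>U\<close> onto \<open>A\<close>; tracing out Z and then
      Y reduces the pairing with \<open>X'\<close> to a pairing of \<open>X\<close> with the output
      of \<open>A\<close>, which is zero by causality.\<close>
    moreover have "trace (M ** A) = trace (X' ** (U ** A ** adj U))"
      unfolding M_def using trace_mul_sym [of "adj U" "X' ** U ** A"] by (simp add: matrix_mul_assoc)
    moreover have "trace (X' ** (U ** A ** adj U)) = trace (X ** Tr_YZ (U ** A ** adj U))"
      by (simp add: X'_def trace_tensor_mul Tr_YZ_def)
    ultimately show "trace (M ** A) = 0" by (simp add: trace_def)
  qed
  have "\<exists>W. unitary W \<and> P ** M ** P = P ** (W \<otimes> mat 1) ** P"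
    if X: "unitary X" and comm: "M ** P = P ** M"
  proof -
    have X': "adj X' ** X' = mat 1" "X' ** adj X' = mat 1"
      using X by (simp_all add: X'_def unitary_def adj_tensor tensor_mul tensor_mat_1)
    have UU: "adj U ** U = mat 1" "U ** adj U = mat 1"
      using assms(6) by (simp_all add: unitary_def)
    have "adj M ** M = adj U ** (adj X' ** (U ** adj U) ** X') ** U"
      and "M ** adj M = adj U ** (X' ** (U ** adj U) ** adj X') ** U"
      unfolding M_def adj_mul adj_adj by (simp_all only: matrix_mul_assoc)
    then have "unitary M"
      by (simp add: unitary_def X' UU)
    with V comm show ?thesis using unitary_extension by blast
  qed
  with V show "(\<exists>W :: ('x \<times> 'y) op.
      P ** adj U ** (X \<otimes> (mat 1 :: 'y op) \<otimes> (mat 1 :: 'z op)) ** U ** P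
        = P ** (W \<otimes> (mat 1 :: 'z op)) ** P) \<and>
    (unitary X \<and>
     (adj U ** (X \<otimes> (mat 1 :: 'y op) \<otimes> (mat 1 :: 'z op)) ** U) ** P
       = P ** (adj U ** (X \<otimes> (mat 1 :: 'y op) \<otimes> (mat 1 :: 'z op)) ** U) \<longrightarrow>
     (\<exists>W :: ('x \<times> 'y) op. unitary W \<and>
      P ** adj U ** (X \<otimes> (mat 1 :: 'y op) \<otimes> (mat 1 :: 'z op)) ** U ** P
        = P ** (W \<otimes> (mat 1 :: 'z op)) ** P))"
    unfolding X'_def [symmetric] PMP M_def [symmetric] by blast
qed

end
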